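(* Let $0\le\alpha<1$ be an exceptional slope. The unique continued fraction expansion $\alpha=[0;a_1,\ldots,a_k]$ with $k$ even is palindromic, and every $a_i$ is either $1$ or $2$. Furthermore, (1) every block of ones in the word $a_1,\ldots,a_k$ has even length, and (2) every block of twos in the word $a_2,\ldots,a_{k-1}$ has even length.
   Context: We work over $\mathbb{C}$. An exceptional slope is the slope $c_1(E)/\operatorname{rk}(E)$ of an exceptional bundle $E$ on $\mathbb{P}^2$, i.e. a stable vector bundle with $\operatorname{Ext}^1(E,E)=0$. Equivalently (Drezet, Le Potier), the set of exceptional slopes is the image of the map $\varepsilon:\mathbb{Z}[\tfrac12]\to\mathbb{Q}$ defined inductively by $\varepsilon(n)=n$ for $n\in\mathbb{Z}$ and $\varepsilon\left(\frac{2p+1}{2^q}\right)=\varepsilon\left(\frac{p}{2^{q-1}}\right).\varepsilon\left(\frac{p+1}{2^{q-1}}\right)$ for $q\ge1$, where $\alpha.\beta=\frac{\alpha+\beta}{2}+\frac{\Delta_\beta-\Delta_\alpha}{3+\alpha-\beta}$, $\Delta_\alpha=\frac12\left(1-\frac{1}{r_\alpha^2}\right)$, and $r_\alpha$ is the denominator of $\alpha$ in lowest terms. $[a_0;a_1,\ldots,a_k]=a_0+\cfrac{1}{a_1+\cfrac{1}{\ddots+\cfrac{1}{a_k}}}$. Every rational $0\le\alpha<1$ has a unique expansion $[0;a_1,\ldots,a_k]$ with $a_i$ positive integers and $k$ even (with $k=0$ for $\alpha=0$). It is palindromic if $a_i=a_{k+1-i}$ for all $i$. A block of ones (twos) in a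 word is a maximal run of consecutive ones (twos). *)

theory Defs
  imports Complex_Main
begin

definition slope_rank :: "rat \<Rightarrow> int" where
  "slope_rank \<alpha> = snd (quotient_of \<alpha>)"

definition slope_discr :: "rat \<Rightarrow> rat" where
  "slope_discr \<alpha> = (1 - 1 / (of_int (slope_rank \<alpha>))\<^sup>2) / 2"

definition slope_dot :: "rat \<Rightarrow> rat \<Rightarrow> rat" where
  "slope_dot \<alpha> \<beta> = (\<alpha> + \<beta>) / 2 + (slope_discr \<beta> - slope_discr \<alpha>) / (3 + \<alpha> - \<beta>)"

text \<open>
  \<open>eps_at q p\<close> is the value of \<open>\<epsilon>\<close> at \<open>p / 2 ^ q\<close>, where the fraction need not be in
  lowest terms: for even \<open>p\<close> it is first reduced.
\<close>

fun eps_at :: "nat \<Rightarrow> int \<Rightarrow> rat" where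
  "eps_at 0 p = of_int p"
| "eps_at (Suc q) p =
     (if even p then eps_at q (p div 2)
      else slope_dot (eps_at q (p div 2)) (eps_at q (p div 2 + 1)))"

definition dyadic_rats :: "rat set" where
  "dyadic_rats = {of_int p / 2 ^ q | p q. True}"

text \<open>
  The description is proper on \<open>dyadic_rats\<close> by \<open>eps_eq_eps_at\<close> below; the lemmas
  \<open>eps_of_int\<close> and \<open>eps_odd\<close> are the usual inductive definition of \<open>\<epsilon>\<close>.
\<close>

definition eps :: "rat \<Rightarrow> rat" where
  "eps x = (THE y. \<exists>p q. x = of_int p / 2 ^ q \<and> y = eps_at q p)"

lemma eps_at_scale: "eps_at (q + n) (2 ^ n * p) = eps_at q p"
  by (induction n) (simp_all add: mult.assoc)

lemma eps_at_cong:
  assumes "(of_int p / 2 ^ q :: rat) = of_int p' / 2 ^ q'"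
  shows "eps_at q p = eps_at q' p'"
proof -
  have "(of_int (2 ^ q' * p) :: rat) = of_int (2 ^ q * p')"
    using assms by (simp add: field_simps)
  then have "2 ^ q' * p = 2 ^ q * p'"
    by (simp only: of_int_eq_iff)
  then show ?thesis
    using eps_at_scale[of q q' p] eps_at_scale[of q' q p'] by (simp add: add.commute)
qed

lemma eps_eq_eps_at: "eps (of_int p / 2 ^ q) = eps_at q p"
  unfolding eps_def by (rule the_equality) (auto dest: eps_at_cong)

lemma eps_of_int: "eps (of_int n) = of_int n"
  using eps_eq_eps_at[of n 0] by simp

lemma eps_odd:
  assumes "q \<ge> 1"
  shows "eps (of_int (2 * p + 1) / 2 ^ q) =
    slope_dot (eps (of_int p / 2 ^ (q - 1))) (eps (of_int (p + 1) / 2 ^ (q - 1)))"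
  using assms unfolding eps_eq_eps_at by (cases q) simp_all

text \<open>
  Exceptional slopes are taken in the form given by the theorem of Drezet and Le Potier,
  rather than as slopes of exceptional bundles on the projective plane.
\<close>

definition exceptional_slopes :: "rat set" where
  "exceptional_slopes = eps ` dyadic_rats"

fun cont_frac :: "int \<Rightarrow> nat list \<Rightarrow> rat" where
  "cont_frac a [] = of_int a"
| "cont_frac a (b # bs) = of_int a + 1 / cont_frac (int b) bs"

text \<open>
  \<open>even_cf_expansion \<alpha> w\<close>: \<open>w\<close> is the word \<open>a\<^sub>1, \<dots>, a\<^sub>k\<close> of an expansion
  \<open>\<alpha> = [0; a\<^sub>1, \<dots>, a\<^sub>k]\<close> with \<open>k\<close> even. The last entry may be \<open>1\<close>.
\<close>

definition even_cf_expansion :: "rat \<Rightarrow> nat list \<Rightarrow> bool" where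
  "even_cf_expansion \<alpha> w \<longleftrightarrow>
     (\<forall>a \<in> set w. a > 0) \<and> even (length w) \<and> \<alpha> = cont_frac 0 w"

text \<open>Words are indexed from \<open>0\<close>, so \<open>a\<^sub>i\<close> is \<open>w ! (i - 1)\<close>.\<close>

definition palindromic :: "'a list \<Rightarrow> bool" where
  "palindromic w \<longleftrightarrow> (\<forall>i \<in> {1..length w}. w ! (i - 1) = w ! (length w + 1 - i - 1))"

text \<open>\<open>is_block c n w\<close>: some maximal run of the letter \<open>c\<close> in \<open>w\<close> has length \<open>n\<close>.\<close>

definition is_block :: "'a \<Rightarrow> nat \<Rightarrow> 'a list \<Rightarrow> bool" where
  "is_block c n w \<longleftrightarrow> n > 0 \<and>
     (\<exists>us vs. w = us @ replicate n c @ vs \<and>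
        (us = [] \<or> last us \<noteq> c) \<and> (vs = [] \<or> hd vs \<noteq> c))"

end

theory Submission
  imports Defs
begin

text \<open>
  Attach to a word \<open>w\<close> the product \<open>M w\<close> of the matrices \<open>[[a, 1], [1, 0]]\<close> over its letters.
  On \<open>[0, 1/2]\<close> the operation \<open>\<alpha>.\<beta>\<close> becomes concatenation: starting from the pair
  \<open>(11, 22)\<close>, which belongs to \<open>(0, 1/2)\<close>, and passing from \<open>(u, v)\<close> to \<open>(u, uv)\<close> and
  \<open>(uv, v)\<close> (Cohn's construction of the Markov numbers), the slope of \<open>u\<close> is \<open>1 - m\<^sub>2\<^sub>2 / m\<^sub>1\<^sub>2\<close>
  for the entries of \<open>M u\<close>, and \<open>tr = 3 m\<^sub>1\<^sub>2\<close> persists by the Cayley-Hamilton theorem.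
  Every new word is \<open>11 P 22\<close> with \<open>P\<close> a product of \<open>11\<close>'s and \<open>22\<close>'s. Its slope is
  \<open>[0; 2 P 2]\<close>, and \<open>1\<close> minus its slope is \<open>[0; 11 P 11]\<close>. The trace condition says exactly that
  \<open>M P\<close> is symmetric, so \<open>P\<close> and its reversal have the same expansion and \<open>P\<close> is a
  palindrome. The interval \<open>[1/2, 1]\<close> follows by \<open>\<alpha> \<mapsto> 1 - \<alpha>\<close>.
\<close>

section \<open>Words and two by two matrices\<close>

datatype mat2 = Mat2 (m11: int) (m12: int) (m21: int) (m22: int)

instantiation mat2 :: monoid_mult
begin

definition "1 = Mat2 1 0 0 1"

fun times_mat2 :: "mat2 \<Rightarrow> mat2 \<Rightarrow> mat2" where
  "Mat2 a b c d * Mat2 a' b' c' d' =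
     Mat2 (a * a' + b * c') (a * b' + b * d') (c * a' + d * c') (c * b' + d * d')"

instance
proof
  fix A B C :: mat2
  show "A * B * C = A * (B * C)"
    by (cases A; cases B; cases C) (simp add: algebra_simps)
  show "1 * A = A" "A * 1 = A"
    by (cases A; simp add: one_mat2_def)+
qed

end

definition mdet :: "mat2 \<Rightarrow> int" where
  "mdet A = m11 A * m22 A - m12 A * m21 A"

definition mtrace :: "mat2 \<Rightarrow> int" where
  "mtrace A = m11 A + m22 A"

definition mtranspose :: "mat2 \<Rightarrow> mat2" where
  "mtranspose A = Mat2 (m11 A) (m21 A) (m12 A) (m22 A)"

lemma mat2_sel_times:
  "m11 (A * B) = m11 A * m11 B + m12 A * m21 B"
  "m12 (A * B) = m11 A * m12 B + m12 A * m22 B"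
  "m21 (A * B) = m21 A * m11 B + m22 A * m21 B"
  "m22 (A * B) = m21 A * m12 B + m22 A * m22 B"
  by (cases A; cases B; simp)+

lemma mat2_sel_one [simp]: "m11 1 = 1" "m12 1 = 0" "m21 1 = 0" "m22 1 = 1"
  by (simp_all add: one_mat2_def)

lemma mdet_times: "mdet (A * B) = mdet A * mdet B"
  by (simp add: mdet_def mat2_sel_times algebra_simps)

lemma mtranspose_times: "mtranspose (A * B) = mtranspose B * mtranspose A"
  by (cases A; cases B) (simp add: mtranspose_def mult.commute)

definition word_mat :: "nat list \<Rightarrow> mat2" where
  "word_mat w = prod_list (map (\<lambda>a. Mat2 (int a) 1 1 0) w)"

lemma word_mat_simps [simp]:
  "word_mat [] = 1"
  "word_mat (a # w) = Mat2 (int a) 1 1 0 * word_mat w"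
  "word_mat (u @ v) = word_mat u * word_mat v"
  by (simp_all add: word_mat_def)

lemma mdet_word_mat: "mdet (word_mat w) = (- 1) ^ length w"
  by (induction w) (simp_all add: mdet_times, simp_all add: mdet_def)

text \<open>Each letter matrix is symmetric, so transposing a product only reverses its
  factors.\<close>

lemma word_mat_rev: "word_mat (rev w) = mtranspose (word_mat w)"
  by (induction w) (simp_all add: mtranspose_times, simp_all add: mtranspose_def one_mat2_def)

text \<open>The last conjunct, a nonzero second column, is what makes \<open>m12\<close> positive
  once a letter is prepended.\<close>

lemma word_mat_pos:
  assumes "\<forall>a \<in> set w. a > 0"
  shows "m11 (word_mat w) > 0 \<and> m12 (word_mat w) \<ge> 0 \<and> m21 (word_mat w) \<ge> 0 \<and>
    m22 (word_mat w) \<ge> 0 \<and> m12 (word_mat w) + m22 (word_mat w) > 0"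
  using assms
proof (induction w)
  case (Cons a w)
  then have IH: "m11 (word_mat w) > 0" "m12 (word_mat w) \<ge> 0" "m21 (word_mat w) \<ge> 0"
      "m22 (word_mat w) \<ge> 0" "m12 (word_mat w) + m22 (word_mat w) > 0" and a: "int a \<ge> 1"
    by auto
  have "int a * m11 (word_mat w) \<ge> 1 * m11 (word_mat w)"
       "int a * m12 (word_mat w) \<ge> 1 * m12 (word_mat w)"
    using IH a by (intro mult_right_mono; linarith)+
  with IH have "int a * m11 (word_mat w) + m21 (word_mat w) > 0"
      "int a * m12 (word_mat w) + m22 (word_mat w) > 0"
    by linarith+
  then show ?case
    using IH by (simp add: mat2_sel_times)
qed simp

lemma m12_word_mat_pos:
  assumes "\<forall>a \<in> set w. a > 0" "w \<noteq> []"
  shows "m12 (word_mat w) > 0"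
proof -
  obtain a v where w: "w = a # v"
    using assms(2) by (cases w) auto
  have v: "m12 (word_mat v) \<ge> 0" "m12 (word_mat v) + m22 (word_mat v) > 0" and a: "int a \<ge> 1"
    using assms(1) word_mat_pos[of v] by (auto simp: w)
  have "int a * m12 (word_mat v) \<ge> 1 * m12 (word_mat v)"
    using v a by (intro mult_right_mono)
  then show ?thesis
    using v by (simp add: w mat2_sel_times)
qed

section \<open>Continued fractions\<close>

lemma cont_frac_add: "cont_frac a w = of_int a + cont_frac 0 w"
  by (cases w) simp_all

lemma cont_frac_0_Cons: "cont_frac 0 (a # w) = 1 / (of_nat a + cont_frac 0 w)"
  using cont_frac_add[of "int a" w] by simp

text \<open>Prepending \<open>a\<close> sends a value t to 1 / (a + t), which is how the letter
  matrix acts on the first column of the product.\<close>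

lemma cont_frac_word_mat:
  assumes "\<forall>a \<in> set w. a > 0"
  shows "cont_frac 0 w = of_int (m21 (word_mat w)) / of_int (m11 (word_mat w))"
  using assms
proof (induction w)
  case (Cons a w)
  then have "m11 (word_mat w) > 0"
    using word_mat_pos[of w] by simp
  with Cons show ?case
    by (simp add: cont_frac_0_Cons mat2_sel_times add_divide_eq_iff del: cont_frac.simps)
qed simp

lemma cont_frac_nonneg: "cont_frac 0 w \<ge> 0"
  by (induction w) (simp, simp add: cont_frac_0_Cons del: cont_frac.simps)

lemma cont_frac_Cons_pos:
  assumes "a > 0"
  shows "cont_frac 0 (a # w) > 0"
  using assms cont_frac_nonneg[of w]
  by (simp add: cont_frac_0_Cons add_pos_nonneg del: cont_frac.simps)

lemma cont_frac_le_1: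
  assumes "\<forall>a \<in> set w. a > 0"
  shows "cont_frac 0 w \<le> 1"
proof (cases w)
  case (Cons a v)
  then have "(of_nat a :: rat) \<ge> 1"
    using assms by simp
  then show ?thesis
    using cont_frac_nonneg[of v] unfolding Cons cont_frac_0_Cons by simp
qed simp

lemma cont_frac_eq_0D:
  assumes "\<forall>a \<in> set w. a > 0" "cont_frac 0 w = 0"
  shows "w = []"
proof (cases w)
  case (Cons a v)
  then show ?thesis
    using assms cont_frac_Cons_pos[of a v] by simp
qed simp

lemma cont_frac_eq_1D:
  assumes "\<forall>a \<in> set w. a > 0" "cont_frac 0 w = 1"
  shows "w = [1]"
proof (cases w)
  case (Cons a v)
  then have a: "(of_nat a :: rat) \<ge> 1"
    using assms by simp
  have "of_nat a + cont_frac 0 v = 1"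
    using assms(2) unfolding Cons cont_frac_0_Cons by simp
  then have "cont_frac 0 v = 0" "(of_nat a :: rat) = 1"
    using a cont_frac_nonneg[of v] by linarith+
  then show ?thesis
    using Cons assms(1) cont_frac_eq_0D[of v] by simp
qed (use assms in simp)

text \<open>Tails take values in [0, 1], so different first letters force the tails
  \<open>[1]\<close> and \<open>[]\<close>, the usual ambiguity of finite expansions. Equal parity
  of the lengths excludes it.\<close>

lemma cont_frac_inject:
  assumes "\<forall>a \<in> set u. a > 0" "\<forall>a \<in> set v. a > 0"
    and "even (length u) = even (length v)" "cont_frac 0 u = cont_frac 0 v"
  shows "u = v"
  using assms
proof (induction u arbitrary: v)
  case Nil
  then have "cont_frac 0 v = 0"
    by simp
  with Nil.prems(2) have "v = []"
    by (rule cont_frac_eq_0D)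
  then show ?case
    by simp
next
  case (Cons a u)
  obtain b t where v: "v = b # t"
    using Cons.prems cont_frac_eq_0D[of "a # u"] by (cases v) auto
  have *: False
    if "x < y" "\<forall>a \<in> set r. a > 0" "\<forall>a \<in> set s. a > 0" "even (length r) = even (length s)"
      "of_nat x + cont_frac 0 r = of_nat y + cont_frac 0 s" for x y r s
  proof -
    have "of_nat x + 1 \<le> (of_nat y :: rat)"
      using that(1) by (metis Suc_eq_plus1 Suc_leI of_nat_1 of_nat_add of_nat_le_iff)
    then have "cont_frac 0 r = 1" "cont_frac 0 s = 0"
      using that(5) cont_frac_le_1[OF that(2)] cont_frac_nonneg[of s] by linarith+
    then have "r = [1]" "s = []"
      using that cont_frac_eq_1D cont_frac_eq_0D by blast+
    then show False
      using that(4) by simp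
  qed
  have eq: "of_nat a + cont_frac 0 u = of_nat b + cont_frac 0 t"
    using Cons.prems(4) unfolding v cont_frac_0_Cons by simp
  have "a = b"
    using *[of a b u t] *[of b a t u] eq Cons.prems unfolding v
    by (cases a b rule: linorder_cases) auto
  then show ?case
    using eq Cons.IH[of t] Cons.prems unfolding v by auto
qed

text \<open>Symmetry gives \<open>w\<close> and \<open>rev w\<close> the same quotient of
  \<open>m21\<close> by \<open>m11\<close>, and their lengths agree.\<close>

lemma word_mat_symmetric_imp_palindrome:
  assumes "\<forall>a \<in> set w. a > 0" "m12 (word_mat w) = m21 (word_mat w)"
  shows "rev w = w"
proof (rule cont_frac_inject)
  show "cont_frac 0 (rev w) = cont_frac 0 w"
    using assms by (simp add: cont_frac_word_mat word_mat_rev mtranspose_def)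
qed (use assms in auto)

section \<open>Slopes of Cohn words\<close>

lemma slope_rank_eqI:
  assumes "\<alpha> = of_int a / of_int x" "x > 0" "coprime a x"
  shows "slope_rank \<alpha> = x"
  using assms by (simp add: slope_rank_def Fract_of_int_quotient[symmetric] quotient_of_Fract
      Rat.normalize_def)

definition mat_slope :: "mat2 \<Rightarrow> rat" where
  "mat_slope A = of_int (m12 A - m22 A) / of_int (m12 A)"

text \<open>A common divisor of numerator and denominator divides the determinant, so the fraction
  is in lowest terms.\<close>

lemma slope_rank_mat_slope:
  assumes "mdet A = 1" "m12 A > 0"
  shows "slope_rank (mat_slope A) = m12 A"
proof (rule slope_rank_eqI)
  show "coprime (m12 A - m22 A) (m12 A)"
  proof (rule coprimeI)
    fix c assume "c dvd m12 A - m22 A" "c dvd m12 A"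
    then have "c dvd m22 A"
      by (metis dvd_diff add_diff_cancel_left' diff_add_cancel)
    then have "c dvd m11 A * m22 A - m12 A * m21 A"
      using \<open>c dvd m12 A\<close> by simp
    then show "is_unit c"
      using assms(1) by (simp add: mdet_def)
  qed
qed (use assms in \<open>simp_all add: mat_slope_def\<close>)

text \<open>The trace condition on \<open>U\<close> turns the denominator in
  \<open>slope_dot\<close> into \<open>z / (x * y)\<close>. The result is then the mean of two
  formulas for \<open>w\<close>, one through \<open>U\<close> and one through
  \<open>V\<close>.\<close>

lemma slope_dot_mat_slope:
  assumes "mdet U = 1" "mdet V = 1"
    and "m12 U > 0" "m12 V > 0" "m12 (U * V) > 0"
    and "mtrace U = 3 * m12 U" "mtrace V = 3 * m12 V" "mtrace (U * V) = 3 * m12 (U * V)"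
  shows "slope_dot (mat_slope U) (mat_slope V) = mat_slope (U * V)"
proof -
  define x y z w where "x = m12 U" "y = m12 V" "z = m12 (U * V)" "w = m22 (U * V)"
  note d = x_y_z_w_def
  have z: "3 * x * y + x * m22 V - y * m22 U = z"
  proof -
    have "3 * x * y = (m11 U + m22 U) * y"
      using assms(6) by (simp add: d mtrace_def)
    then show ?thesis
      by (simp add: d mat2_sel_times algebra_simps)
  qed
  \<comment> \<open>This is the upper right entry of U^(-1) (U V) = V.\<close>
  have xw: "x * w = z * m22 U - y"
  proof -
    have "x * w = (m12 U * m21 U) * y + x * m22 U * m22 V"
      by (simp add: d mat2_sel_times algebra_simps)
    also have "m12 U * m21 U = m11 U * m22 U - 1"
      using assms(1) by (simp add: mdet_def)
    finally show ?thesis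
      by (simp add: d mat2_sel_times algebra_simps)
  qed
  \<comment> \<open>This is the upper right entry of (U V) V^(-1) = U, with \<open>m11 V\<close> and
    \<open>m11 (U * V)\<close> eliminated by the trace conditions.\<close>
  have yw: "y * w = z * m22 V + x"
  proof -
    have "y * w = y * (3 * z - m11 (U * V))"
      using assms(8) by (simp add: d mtrace_def)
    also have "\<dots> = z * (3 * y) - m11 U * m11 V * y - x * (m12 V * m21 V)"
      by (simp add: d mat2_sel_times algebra_simps)
    also have "m12 V * m21 V = m11 V * m22 V - 1"
      using assms(2) by (simp add: mdet_def)
    also have "3 * y = m11 V + m22 V"
      using assms(7) by (simp add: d mtrace_def)
    finally show ?thesis
      by (simp add: d mat2_sel_times algebra_simps)
  qed
  define X Y Z W P Q :: rat
    where "X = of_int x" "Y = of_int y" "Z = of_int z" "W = of_int w"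
      "P = of_int (m22 U)" "Q = of_int (m22 V)"
  note D = X_Y_Z_W_P_Q_def
  have pos: "X > 0" "Y > 0" "Z > 0"
    using assms by (simp_all add: D d)
  have Z: "3 * X * Y + X * Q - Y * P = Z"
    unfolding D z[symmetric] by simp
  have XW: "X * W = Z * P - Y" and YW: "Y * W = Z * Q + X"
    unfolding D of_int_mult[symmetric] of_int_diff[symmetric] of_int_add[symmetric] xw yw
    by simp_all
  have sl: "mat_slope U = 1 - P / X" "mat_slope V = 1 - Q / Y" "mat_slope (U * V) = 1 - W / Z"
    using pos by (simp_all add: mat_slope_def D d diff_divide_distrib)
  have den: "3 + mat_slope U - mat_slope V = Z / (X * Y)"
    using pos unfolding sl Z[symmetric] by (simp add: field_simps)
  have num: "slope_discr (mat_slope V) - slope_discr (mat_slope U) = (Y\<^sup>2 - X\<^sup>2) / (2 * X\<^sup>2 * Y\<^sup>2)"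
    using pos assms(1-4) unfolding slope_discr_def
    by (simp add: slope_rank_mat_slope D d field_simps)
  have "slope_dot (mat_slope U) (mat_slope V) =
      1 - (P / X + Q / Y) / 2 + ((Y\<^sup>2 - X\<^sup>2) / (2 * X\<^sup>2 * Y\<^sup>2)) / (Z / (X * Y))"
    unfolding slope_dot_def den num by (simp add: sl field_simps)
  also have "\<dots> = 1 - (Y * (Z * P - Y) + X * (Z * Q + X)) / (2 * X * Y * Z)"
    using pos by (simp add: field_simps power2_eq_square)
  also have "\<dots> = 1 - W / Z"
    using pos unfolding XW[symmetric] YW[symmetric] by (simp add: field_simps)
  finally show ?thesis
    unfolding sl .
qed

section \<open>The tree of Cohn words\<close>

inductive cohn_pair :: "nat list \<Rightarrow> nat list \<Rightarrow> bool" where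
  base: "cohn_pair [1, 1] [2, 2]"
| left: "cohn_pair u v \<Longrightarrow> cohn_pair u (u @ v)"
| right: "cohn_pair u v \<Longrightarrow> cohn_pair (u @ v) v"

definition markov_mat :: "mat2 \<Rightarrow> bool" where
  "markov_mat A \<longleftrightarrow> mtrace A = 3 * m12 A"

text \<open>Cayley-Hamilton: \<open>U\<^sup>2 V = tr(U) U V - det(U) V\<close>, and similarly for \<open>U V\<^sup>2\<close>.\<close>

lemma markov_mat_times_left:
  assumes "mdet U = 1" "markov_mat U" "markov_mat V" "markov_mat (U * V)"
  shows "markov_mat (U * (U * V))"
  using assms unfolding markov_mat_def mdet_def mtrace_def mat2_sel_times by algebra

lemma markov_mat_times_right:
  assumes "mdet V = 1" "markov_mat U" "markov_mat V" "markov_mat (U * V)"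
  shows "markov_mat (U * V * V)"
  using assms unfolding markov_mat_def mdet_def mtrace_def mat2_sel_times by algebra

text \<open>Doubled words over 1 and 2 are exactly the products of 11 and 22, so the parity of
  blocks can be read off from the form of the word.\<close>

definition double :: "'a list \<Rightarrow> 'a list" where
  "double w = concat (map (\<lambda>a. [a, a]) w)"

lemma double_simps [simp]:
  "double [] = []" "double (a # w) = a # a # double w" "double (u @ v) = double u @ double v"
  by (simp_all add: double_def)

lemma set_double [simp]: "set (double w) = set w"
  by (induction w) auto

lemma even_length_double [simp]: "even (length (double w))"
  by (induction w) auto

text \<open>The clause on \<open>hd s\<close> separates \<open>v\<close> = 22 from the shape 11 P
  22. Rule \<open>left\<close> makes the new second word start with \<open>u\<close>, and rule
  \<open>right\<close> keeps \<open>v\<close>.\<close>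

lemma cohn_pair_double:
  assumes "cohn_pair u v"
  shows "\<exists>r s. u = double (1 # r) \<and> v = double (s @ [2]) \<and> set r \<subseteq> {1, 2} \<and> set s \<subseteq> {1, 2} \<and>
    (s = [] \<or> hd s = 1)"
  using assms
proof induction
  case base
  then show ?case
    by (intro exI[of _ "[]"]) simp
next
  case (left u v)
  then obtain r s where "u = double (1 # r)" "v = double (s @ [2])" "set r \<subseteq> {1, 2}"
      "set s \<subseteq> {1, 2}"
    by auto
  then show ?case
    by (intro exI[of _ r] exI[of _ "1 # r @ s"]) simp
next
  case (right u v)
  then obtain r s where "u = double (1 # r)" "v = double (s @ [2])" "set r \<subseteq> {1, 2}"
      "set s \<subseteq> {1, 2}" "s = [] \<or> hd s = 1"
    by auto
  then show ?case
    by (intro exI[of _ "r @ s @ [2]"] exI[of _ s]) simp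
qed

lemma cohn_pair_letters:
  assumes "cohn_pair u v"
  shows "\<forall>a \<in> set u \<union> set v. a > 0" "u \<noteq> []" "v \<noteq> []"
  using assms by (induction) auto

lemma cohn_pair_mdet:
  assumes "cohn_pair u v"
  shows "mdet (word_mat u) = 1" "mdet (word_mat v) = 1"
  using cohn_pair_double[OF assms] by (auto simp: mdet_word_mat simp del: double_simps)

text \<open>The concatenation is part of the claim because Cayley-Hamilton expresses the next
  product through all three matrices.\<close>

lemma cohn_pair_markov:
  assumes "cohn_pair u v"
  shows "markov_mat (word_mat u) \<and> markov_mat (word_mat v) \<and> markov_mat (word_mat (u @ v))"
  using assms
proof induction
  case base
  then show ?case
    by (simp add: markov_mat_def mtrace_def one_mat2_def)
next
  case (left u v)
  then show ?case
    using markov_mat_times_left cohn_pair_mdet by simp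
next
  case (right u v)
  then show ?case
    using markov_mat_times_right cohn_pair_mdet by (simp add: mult.assoc[symmetric])
qed

lemma cohn_pair_slope_dot:
  assumes "cohn_pair u v"
  shows "slope_dot (mat_slope (word_mat u)) (mat_slope (word_mat v)) =
    mat_slope (word_mat (u @ v))"
  unfolding word_mat_simps
proof (rule slope_dot_mat_slope)
  note l = cohn_pair_letters[OF assms]
  show "m12 (word_mat u) > 0" "m12 (word_mat v) > 0" "m12 (word_mat u * word_mat v) > 0"
    using l m12_word_mat_pos[of u] m12_word_mat_pos[of v] m12_word_mat_pos[of "u @ v"]
    by auto
qed (use assms cohn_pair_mdet cohn_pair_markov in \<open>auto simp: markov_mat_def\<close>)

text \<open>Halving a dyadic interval inserts the concatenation at its midpoint, and the two halves
  are the rules \<open>left\<close> and \<open>right\<close>. Level \<open>Suc q\<close> with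
  \<open>p < 2 ^ q\<close> keeps both ends in [0, 1/2].\<close>

lemma eps_at_cohn_pair:
  assumes "0 \<le> p" "p < 2 ^ q"
  shows "\<exists>u v. cohn_pair u v \<and> eps_at (Suc q) p = mat_slope (word_mat u) \<and>
    eps_at (Suc q) (p + 1) = mat_slope (word_mat v)"
  using assms
proof (induction q arbitrary: p)
  case 0
  have "slope_rank 0 = 1" "slope_rank 1 = 1"
    by (simp_all add: slope_rank_def)
  then have "eps_at (Suc 0) 0 = 0" "eps_at (Suc 0) (0 + 1) = 1 / 2"
    by (simp_all add: slope_dot_def slope_discr_def)
  moreover have "mat_slope (word_mat [1, 1]) = 0" "mat_slope (word_mat [2, 2]) = 1 / 2"
    by (simp_all add: mat_slope_def one_mat2_def)
  moreover have "p = 0"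
    using 0 by simp
  ultimately show ?case
    using cohn_pair.base by metis
next
  case (Suc q)
  have "0 \<le> p div 2" "p div 2 < 2 ^ q"
    using Suc.prems by auto
  then obtain u v where uv: "cohn_pair u v" "eps_at (Suc q) (p div 2) = mat_slope (word_mat u)"
      "eps_at (Suc q) (p div 2 + 1) = mat_slope (word_mat v)"
    using Suc.IH by blast
  have dot: "slope_dot (eps_at (Suc q) (p div 2)) (eps_at (Suc q) (p div 2 + 1)) =
      mat_slope (word_mat (u @ v))"
    unfolding uv by (rule cohn_pair_slope_dot[OF uv(1)])
  show ?case
  proof (cases "even p")
    case True
    then have "(p + 1) div 2 = p div 2"
      by presburger
    then show ?thesis
      using True uv dot cohn_pair.left[OF uv(1)]
      by (intro exI[of _ u] exI[of _ "u @ v"])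
        (simp del: word_mat_simps eps_at.simps add: eps_at.simps(2)[of "Suc q"])
  next
    case False
    then have "(p + 1) div 2 = p div 2 + 1"
      by presburger
    then show ?thesis
      using False uv dot cohn_pair.right[OF uv(1)]
      by (intro exI[of _ "u @ v"] exI[of _ v])
        (simp del: word_mat_simps eps_at.simps add: eps_at.simps(2)[of "Suc q"])
  qed
qed

section \<open>Reflection and translation\<close>

lemma slope_rank_reflect_translate:
  "slope_rank (of_int n - \<alpha>) = slope_rank \<alpha>" "slope_rank (of_int n + \<alpha>) = slope_rank \<alpha>"
proof -
  obtain a x where q: "quotient_of \<alpha> = (a, x)"
    by (cases "quotient_of \<alpha>")
  note \<alpha> = quotient_of_div[OF q]
  note x = quotient_of_denom_pos[OF q]
  note c = quotient_of_coprime[OF q]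
  have r: "slope_rank \<alpha> = x"
    by (simp add: slope_rank_def q)
  have "coprime (n * x - a) x"
  proof (rule coprimeI)
    fix k assume k: "k dvd n * x - a" "k dvd x"
    then have "k dvd n * x - (n * x - a)"
      using dvd_diff[OF dvd_mult] by blast
    then have "k dvd a"
      by simp
    then show "is_unit k"
      using k(2) by (rule coprime_common_divisor[OF c])
  qed
  moreover have "coprime (n * x + a) x"
  proof (rule coprimeI)
    fix k assume k: "k dvd n * x + a" "k dvd x"
    then have "k dvd n * x + a - n * x"
      by (intro dvd_diff dvd_mult)
    then have "k dvd a"
      by simp
    then show "is_unit k"
      using k(2) by (rule coprime_common_divisor[OF c])
  qed
  ultimately show "slope_rank (of_int n - \<alpha>) = slope_rank \<alpha>"
    "slope_rank (of_int n + \<alpha>) = slope_rank \<alpha>"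
    unfolding r using x slope_rank_eqI[of _ "n * x - a" x] slope_rank_eqI[of _ "n * x + a" x]
    by (simp_all add: \<alpha> field_simps)
qed

lemma slope_discr_reflect_translate [simp]:
  "slope_discr (1 - \<alpha>) = slope_discr \<alpha>" "slope_discr (of_int n + \<alpha>) = slope_discr \<alpha>"
  using slope_rank_reflect_translate(1)[of 1] slope_rank_reflect_translate(2)
  by (simp_all add: slope_discr_def)

lemma slope_dot_reflect: "slope_dot (1 - \<beta>) (1 - \<alpha>) = 1 - slope_dot \<alpha> \<beta>"
proof -
  have "(slope_discr \<alpha> - slope_discr \<beta>) / (3 + \<alpha> - \<beta>) =
      - ((slope_discr \<beta> - slope_discr \<alpha>) / (3 + \<alpha> - \<beta>))"
    by (simp add: minus_divide_left)
  moreover have "3 + (1 - \<beta>) - (1 - \<alpha>) = 3 + \<alpha> - \<beta>"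
    by simp
  ultimately show ?thesis
    by (simp add: slope_dot_def field_simps)
qed

lemma slope_dot_translate: "slope_dot (of_int n + \<alpha>) (of_int n + \<beta>) = of_int n + slope_dot \<alpha> \<beta>"
proof -
  have "of_int n + \<alpha> + (of_int n + \<beta>) = 2 * of_int n + (\<alpha> + \<beta>)"
      "3 + (of_int n + \<alpha>) - (of_int n + \<beta>) = 3 + \<alpha> - \<beta>"
    by simp_all
  then show ?thesis
    unfolding slope_dot_def slope_discr_reflect_translate
    by (simp only:) (simp add: add_divide_distrib)
qed

lemma eps_at_reflect: "eps_at q (2 ^ q - p) = 1 - eps_at q p"
proof (induction q arbitrary: p)
  case (Suc q)
  show ?case
  proof (cases "even p")
    case True
    then have "(2 ^ Suc q - p) div 2 = 2 ^ q - p div 2"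
      by auto
    then show ?thesis
      using True Suc by simp
  next
    case False
    \<comment> \<open>Halving rounds down, so for odd \<open>p\<close> reflection exchanges the
      lower and upper neighbours, as in \<open>slope_dot_reflect\<close>.\<close>
    then have "(2 ^ Suc q - p) div 2 = 2 ^ q - (p div 2 + 1)"
      by (auto elim!: oddE)
    moreover from this have "(2 ^ Suc q - p) div 2 + 1 = 2 ^ q - p div 2"
      by simp
    ultimately show ?thesis
      using False Suc by (simp add: slope_dot_reflect)
  qed
qed simp

lemma eps_at_translate: "eps_at q (n * 2 ^ q + p) = of_int n + eps_at q p"
proof (induction q arbitrary: p)
  case (Suc q)
  have "(n * 2 ^ Suc q + p) div 2 = n * 2 ^ q + p div 2"
    by simp
  then show ?case
    using Suc[of "p div 2"] Suc[of "p div 2 + 1"]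
    by (simp add: slope_dot_translate add.assoc)
qed simp

section \<open>The shape of the expansions\<close>

text \<open>The vector (2, 1) is the top row of the matrices of 11 and of 2, the first column of
  both, and the second column of that of 22. So all denominators agree, and the numerators use the
  bottom rows (1, 0) of 2 and (1, 1) of 11.\<close>

lemma mat_slope_cohn_word:
  assumes "w = [1, 1] @ P @ [2, 2]" "\<forall>a \<in> set P. a > 0"
  shows "mat_slope (word_mat w) = cont_frac 0 ([2] @ P @ [2])"
    "1 - mat_slope (word_mat w) = cont_frac 0 ([1, 1] @ P @ [1, 1])"
proof -
  have 1: "\<forall>a \<in> set w. a > 0"
    using assms by auto
  then have "m12 (word_mat w) > 0"
    using assms(1) by (intro m12_word_mat_pos) auto
  then have "1 - mat_slope (word_mat w) = of_int (m22 (word_mat w)) / of_int (m12 (word_mat w))"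
    by (simp add: mat_slope_def field_simps)
  moreover have "\<forall>a \<in> set ([2] @ P @ [2]). a > 0" "\<forall>a \<in> set ([1, 1] @ P @ [1, 1]). a > 0"
    using assms(2) by auto
  ultimately show "mat_slope (word_mat w) = cont_frac 0 ([2] @ P @ [2])"
    "1 - mat_slope (word_mat w) = cont_frac 0 ([1, 1] @ P @ [1, 1])"
    by (simp_all only: cont_frac_word_mat mat_slope_def)
      (simp_all add: assms(1) mat2_sel_times algebra_simps)
qed

text \<open>The trace minus three times \<open>m12\<close> of the long product equals
  \<open>m21 - m12\<close> of \<open>word_mat P\<close>.\<close>

lemma markov_mat_cohn_word:
  assumes "markov_mat (word_mat ([1, 1] @ P @ [2, 2]))"
  shows "m12 (word_mat P) = m21 (word_mat P)"
  using assms by (simp add: markov_mat_def mtrace_def mat2_sel_times)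

section \<open>Parity of blocks in doubled words\<close>

text \<open>A run that starts or ends inside a doubled letter has that letter next to it, against
  maximality. Allowing \<open>n = 0\<close> lets the induction remove pairs from the run
  itself.\<close>

lemma double_block_even:
  assumes "double w = us @ replicate n c @ vs" "us = [] \<or> last us \<noteq> c" "vs = [] \<or> hd vs \<noteq> c"
  shows "even n"
  using assms
proof (induction w arbitrary: us n)
  case (Cons a w)
  consider "us = []" | b where "us = [b]" | b b' us' where "us = b # b' # us'"
    by (metis list.exhaust)
  then show ?case
  proof cases
    case 1
    consider "n = 0" | "n = 1" | k where "n = Suc (Suc k)"
      by (metis One_nat_def not0_implies_Suc)
    then show ?thesis
      using 1 Cons.IH[of "[]"] Cons.prems by cases auto
  next
    case 2
    then show ?thesis
      using Cons.prems by (cases n) auto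
  next
    case 3
    then show ?thesis
      using Cons.IH[of us' n] Cons.prems by (auto split: if_splits)
  qed
qed simp

lemma is_block_double: "is_block c n (double w) \<Longrightarrow> even n"
  unfolding is_block_def using double_block_even by metis

lemma is_block_enclosed:
  assumes "is_block c n (d # w @ [d])" "d \<noteq> c"
  shows "is_block c n w"
proof -
  obtain us vs where n: "n > 0" and eq: "d # w @ [d] = us @ replicate n c @ vs"
    and us: "us = [] \<or> last us \<noteq> c" and vs: "vs = [] \<or> hd vs \<noteq> c"
    using assms(1) by (auto simp: is_block_def)
  obtain us' where us': "us = d # us'"
    using eq n assms(2) by (cases us; cases n) auto
  obtain vs' where vs': "vs = vs' @ [d]"
  proof (cases vs rule: rev_cases)
    case Nil
    have "last (d # w @ [d]) = last (us @ replicate n c @ vs)"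
      using eq by simp
    then show ?thesis
      using Nil n assms(2) by simp
  next
    case (snoc vs' e)
    then show ?thesis
      using that[of vs'] arg_cong[OF eq, of last] by simp
  qed
  have "w = us' @ replicate n c @ vs'"
    using eq by (simp add: us' vs')
  then show ?thesis
    using n us vs unfolding is_block_def us' vs'
    by (intro conjI exI[of _ us'] exI[of _ vs']) (auto split: if_splits simp: hd_append)
qed

definition good_word :: "nat list \<Rightarrow> bool" where
  "good_word w \<longleftrightarrow> even (length w) \<and> rev w = w \<and> set w \<subseteq> {1, 2} \<and>
     (\<forall>n. is_block 1 n w \<longrightarrow> even n) \<and> (\<forall>n. is_block 2 n (butlast (tl w)) \<longrightarrow> even n)"

lemma good_word_small: "good_word []" "good_word [1, 1]"
  using is_block_double[of _ _ "[] :: nat list"] is_block_double[of _ _ "[1 :: nat]"]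
  by (auto simp: good_word_def)

text \<open>The outer twos of 2 P 2 may lengthen runs of twos in P, but
  \<open>butlast (tl _)\<close> removes just these. The word 11 P 11 is doubled as a whole, and
  trimming it leaves 1 P 1.\<close>

lemma good_word_extend:
  assumes "P = double Q" "set Q \<subseteq> {1, 2}" "rev P = P"
  shows "good_word ([2] @ P @ [2])" "good_word ([1, 1] @ P @ [1, 1])"
proof -
  have "is_block 1 n ([2] @ P @ [2]) \<Longrightarrow> even n" for n
    using is_block_enclosed[of 1 n 2 P] is_block_double[of _ _ Q] by (simp add: assms(1))
  moreover have "is_block 2 n P \<Longrightarrow> even n" for n
    using is_block_double[of _ _ Q] by (simp add: assms(1))
  moreover have "is_block 1 n ([1, 1] @ P @ [1, 1]) \<Longrightarrow> even n" for n
    using is_block_double[of _ n "1 # Q @ [1]"] by (simp add: assms(1))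
  moreover have "is_block 2 n ([1] @ P @ [1]) \<Longrightarrow> even n" for n
    using is_block_enclosed[of 2 n 1 P] is_block_double[of _ _ Q] by (simp add: assms(1))
  moreover have "butlast (tl ([1, 1] @ P @ [1, 1])) = [1] @ P @ [1]"
    by (simp add: butlast_append)
  moreover have "set P \<subseteq> {1, 2}" "even (length P)"
    using assms by auto
  ultimately show "good_word ([2] @ P @ [2])" "good_word ([1, 1] @ P @ [1, 1])"
    using assms(3) unfolding good_word_def by (auto simp: butlast_append)
qed

section \<open>From Cohn pairs to all exceptional slopes in [0, 1)\<close>

text \<open>Every dyadic point of (0, 1/2] is the right end of an interval in
  \<open>eps_at_cohn_pair\<close>, so second words suffice.\<close>

lemma good_expansion_right_half:
  assumes "cohn_pair u v"
  shows "\<exists>w w'. good_word w \<and> mat_slope (word_mat v) = cont_frac 0 w \<and>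
    good_word w' \<and> 1 - mat_slope (word_mat v) = cont_frac 0 w' \<and> w \<noteq> []"
proof -
  obtain s where v: "v = double (s @ [2])" and s: "set s \<subseteq> {1, 2}" "s = [] \<or> hd s = 1"
    using cohn_pair_double[OF assms] by blast
  show ?thesis
  proof (cases s)
    \<comment> \<open>Here \<open>v\<close> is 22, and both the slope and its complement are 1/2 =
      [0; 1, 1].\<close>
    case Nil
    then show ?thesis
      using good_word_small v
      by (intro exI[of _ "[1, 1]"]) (simp add: mat_slope_def one_mat2_def)
  next
    case (Cons a Q)
    then have v': "v = [1, 1] @ double Q @ [2, 2]" and Q: "set Q \<subseteq> {1, 2}"
      using v s by auto
    then have pos: "\<forall>a \<in> set (double Q). a > 0"
      by auto
    have "rev (double Q) = double Q"
      using cohn_pair_markov[OF assms] markov_mat_cohn_word[of "double Q"] pos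
      by (intro word_mat_symmetric_imp_palindrome) (simp_all only: v')
    then show ?thesis
      using good_word_extend[OF refl Q] mat_slope_cohn_word[OF v' pos] by blast
  qed
qed

lemma eps_at_good_expansion:
  assumes "0 \<le> p" "p < 2 ^ q"
  shows "\<exists>w. good_word w \<and> eps_at q p = cont_frac 0 w \<and> eps_at q p < 1"
proof -
  have half: "\<exists>w w'. good_word w \<and> eps_at (Suc q) r = cont_frac 0 w \<and>
      good_word w' \<and> 1 - eps_at (Suc q) r = cont_frac 0 w' \<and> w \<noteq> []"
    if "0 < r" "r \<le> 2 ^ q" for r
    using that eps_at_cohn_pair[of "r - 1" q] good_expansion_right_half by fastforce
  \<comment> \<open>Passing to level \<open>Suc q\<close> makes \<open>half\<close> applicable to
    the point p / 2^q itself.\<close>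
  have scale: "eps_at (Suc q) (2 * p) = eps_at q p"
    by simp
  have pos: "\<forall>a \<in> set w. a > 0" if "good_word w" for w
    using that by (auto simp: good_word_def)
  consider "p = 0" | "0 < 2 * p" "2 * p \<le> 2 ^ q" | "2 ^ q < 2 * p"
    using assms by linarith
  then show ?thesis
  proof cases
    case 1
    have "eps_at q 0 = 0"
      by (induction q) simp_all
    then show ?thesis
      using 1 good_word_small by (intro exI[of _ "[]"]) simp
  next
    case 2
    then obtain w w' where w: "good_word w" "eps_at q p = cont_frac 0 w"
        "good_word w'" "1 - eps_at q p = cont_frac 0 w'"
      using half[of "2 * p"] unfolding scale by blast
    \<comment> \<open>An empty \<open>w'\<close> would mean slope 1, whose only expansion
      \<open>[1]\<close> has odd length.\<close>
    have "w' = [] \<Longrightarrow> w = [1]"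
      using w cont_frac_eq_1D[OF pos] by simp
    then have "w' \<noteq> []"
      using w by (auto simp: good_word_def)
    then have "cont_frac 0 w' \<noteq> 0"
      using cont_frac_eq_0D[OF pos] w by blast
    then have "eps_at q p < 1"
      using w cont_frac_nonneg[of w'] by linarith
    then show ?thesis
      using w by blast
  next
    case 3
    \<comment> \<open>The numerator of the reflected point 1 - p / 2^q at level
      \<open>Suc q\<close>.\<close>
    define r where "r = 2 ^ Suc q - 2 * p"
    have "0 < r" "r \<le> 2 ^ q" "eps_at (Suc q) r = 1 - eps_at q p"
      using 3 assms(2) eps_at_reflect[of "Suc q" "2 * p"] unfolding r_def scale by simp_all
    then obtain w w' where w: "good_word w" "1 - eps_at q p = cont_frac 0 w" "w \<noteq> []"
        "good_word w'" "eps_at q p = cont_frac 0 w'"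
      using half[of r] by auto
    have "cont_frac 0 w \<noteq> 0"
      using cont_frac_eq_0D[OF pos] w by blast
    then have "eps_at q p < 1"
      using w cont_frac_nonneg[of w] by linarith
    then show ?thesis
      using w by blast
  qed
qed

lemma exceptional_slope_good_expansion:
  assumes "\<alpha> \<in> exceptional_slopes" "0 \<le> \<alpha>" "\<alpha> < 1"
  shows "\<exists>w. good_word w \<and> \<alpha> = cont_frac 0 w"
proof -
  obtain p q where \<alpha>: "\<alpha> = eps_at q p"
    using assms(1) by (auto simp: exceptional_slopes_def dyadic_rats_def eps_eq_eps_at)
  define n r where "n = p div 2 ^ q" "r = p mod 2 ^ q"
  have "0 \<le> r" "r < 2 ^ q"
    by (simp_all add: n_r_def)
  then obtain w where w: "good_word w" "eps_at q r = cont_frac 0 w" "eps_at q r < 1"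
    using eps_at_good_expansion by blast
  have "p = n * 2 ^ q + r"
    unfolding n_r_def by (rule div_mult_mod_eq[symmetric])
  then have \<alpha>': "\<alpha> = of_int n + eps_at q r"
    using eps_at_translate[of q n r] by (simp add: \<alpha>)
  \<comment> \<open>Since the fractional part of the dyadic argument has its value in [0, 1), the
    integer part of \<alpha> is \<open>n\<close>.\<close>
  have "(of_int n :: rat) < 1" "(of_int n :: rat) > - 1"
    using \<alpha>' w assms(2,3) cont_frac_nonneg[of w] by linarith+
  then have "n = 0"
    by linarith
  then show ?thesis
    using \<alpha>' w by auto
qed

lemma palindromic_if_rev_eq:
  assumes "rev w = w"
  shows "palindromic w"
  unfolding palindromic_def
proof
  fix i assume "i \<in> {1..length w}"
  then show "w ! (i - 1) = w ! (length w + 1 - i - 1)"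
    using rev_nth[of "i - 1" w] assms by auto
qed

theorem theorem3p2:
  fixes \<alpha> :: rat
  assumes "\<alpha> \<in> exceptional_slopes" and "0 \<le> \<alpha>" and "\<alpha> < 1"
  shows "(\<exists>!w. even_cf_expansion \<alpha> w) \<and>
    (\<forall>w. even_cf_expansion \<alpha> w \<longrightarrow>
       palindromic w \<and>
       (\<forall>a \<in> set w. a = 1 \<or> a = 2) \<and>
       (\<forall>n. is_block 1 n w \<longrightarrow> even n) \<and>
       (\<forall>n. is_block 2 n (butlast (tl w)) \<longrightarrow> even n))"
proof -
  obtain w where w: "good_word w" "\<alpha> = cont_frac 0 w"
    using exceptional_slope_good_expansion[OF assms] by blast
  then have "even_cf_expansion \<alpha> w"
    by (auto simp: even_cf_expansion_def good_word_def)
  moreover from this have "v = w" if "even_cf_expansion \<alpha> v" for v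
    using that by (intro cont_frac_inject) (auto simp: even_cf_expansion_def)
  ultimately show ?thesis
    using w(1) palindromic_if_rev_eq unfolding good_word_def by blast
qed

end
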